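(* Let $G\cong H[G_1,\dots,G_k]$, where $H$ is a cograph with vertex set $\{1,\dots,k\}$ and $G_1,\dots,G_k$ are pairwise disjoint cographs. If each $G_i$ has order at least $3$ and possesses property (P), then $G$ has property (P).
   Context: Graphs are finite and simple. For a graph $G$ on vertex set $\{1,\dots,n\}$, $S(G)$ is the set of real symmetric $n\times n$ matrices $A$ such that for all $i\ne j$, $A_{ij}\neq 0$ if and only if $ij\in E(G)$ (diagonal entries are unrestricted). $A(i)$ denotes the principal submatrix of $A$ obtained by deleting row and column $i$, and $m_A(0)$ the multiplicity of $0$ as an eigenvalue of $A$. A vertex $i$ is a P-vertex of $A$ if $m_{A(i)}(0)-m_A(0)=1$, and $P_\nu(A)$ is the number of P-vertices of $A$. $G$ has property (P) if there exists a nonsingular $A\in S(G)$ with $P_\nu(A)=n$ (equivalently, a nonsingular $A\in S(G)$ with $\det A(i)=0$ for all $i$, i.e. $A^{-1}$ has zero diagonal). The $H$-join $H[G_1,\dots,G_k]$ is the graph obtained from the disjoint union of $G_1,\dots,G_k$ by joining every vertex of $G_i$ to every vertex of $G_j$ whenever $ij\in E(H)$. A cograph is a graph with no induced subgraph isomorphic to the path $P_4$ on four vertices. *)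

theory Defs
  imports
    "Graph_Theory.Pair_Digraph"
    "Graph_Theory.Digraph_Isomorphism"
    "Jordan_Normal_Form.Char_Poly"
    "HOL-Library.Disjoint_Sets"
begin

text \<open>
  A finite simple graph is a \<^locale>\<open>pair_graph\<close>: a finite, symmetric, loop-free digraph without
  parallel arcs. An edge ij is thus represented by the two arcs (i,j) and (j,i).
\<close>

definition path4 :: "nat pair_pre_digraph" where
  "path4 = \<lparr> pverts = {1, 2, 3, 4},
             parcs = {(1, 2), (2, 1), (2, 3), (3, 2), (3, 4), (4, 3)} \<rparr>"

definition cograph :: "'a pair_pre_digraph \<Rightarrow> bool" where
  "cograph G \<longleftrightarrow> pair_graph G \<and>
     \<not> (\<exists>F. induced_subgraph F (with_proj G) \<and> digraph_iso F (with_proj path4))"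

text \<open>The disjointness of the vertex sets of the \<open>Gs i\<close> is not built in here.\<close>

definition h_join :: "'i pair_pre_digraph \<Rightarrow> ('i \<Rightarrow> 'a pair_pre_digraph) \<Rightarrow> 'a pair_pre_digraph" where
  "h_join H Gs = \<lparr> pverts = (\<Union>i \<in> pverts H. pverts (Gs i)),
     parcs = (\<Union>i \<in> pverts H. parcs (Gs i)) \<union>
             (\<Union>(i, j) \<in> parcs H. pverts (Gs i) \<times> pverts (Gs j)) \<rparr>"

text \<open>
  \<open>sym_mats n G\<close> is S(G) for a graph G with vertex set \<open>{0..<n}\<close>; the vertices are numbered from 0
  because the matrix indices are.
\<close>

definition sym_mats :: "nat \<Rightarrow> nat pair_pre_digraph \<Rightarrow> real mat set" where
  "sym_mats n G = {A \<in> carrier_mat n n. transpose_mat A = A \<and>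
     (\<forall>i < n. \<forall>j < n. i \<noteq> j \<longrightarrow> (A $$ (i, j) \<noteq> 0 \<longleftrightarrow> (i, j) \<in> parcs G))}"

text \<open>
  Multiplicity of an eigenvalue (0 if x is not an eigenvalue). For real symmetric matrices the
  algebraic multiplicity used here and the geometric one agree.
\<close>

definition eig_mult :: "real mat \<Rightarrow> real \<Rightarrow> nat" where
  "eig_mult A x = Polynomial.order x (char_poly A)"

definition P_vertex :: "real mat \<Rightarrow> nat \<Rightarrow> bool" where
  "P_vertex A i \<longleftrightarrow> int (eig_mult (mat_delete A i i) 0) - int (eig_mult A 0) = 1"

definition P_nu :: "real mat \<Rightarrow> nat" where
  "P_nu A = card {i. i < dim_row A \<and> P_vertex A i}"

text \<open>
  S(G) presupposes the vertex set \<open>{0..<n}\<close>, so the vertices of an arbitrary finite graph are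
  first numbered by passing to an isomorphic copy \<open>G'\<close>. The choice of numbering is immaterial: a
  different one conjugates the matrices by a permutation matrix.
\<close>

definition property_P :: "'a pair_pre_digraph \<Rightarrow> bool" where
  "property_P G \<longleftrightarrow> (\<exists>n (G' :: nat pair_pre_digraph).
     pverts G' = {0..<n} \<and> digraph_iso (with_proj G) (with_proj G') \<and>
     (\<exists>A \<in> sym_mats n G'. invertible_mat A \<and> P_nu A = n))"

end

theory Submission
  imports Defs
begin

text \<open>
  For a nonsingular symmetric A, the vertex i is a P-vertex iff the i-th diagonal entry of
  \<open>A\<^sup>-\<^sup>1\<close> vanishes. Let \<open>A\<^sub>i\<close> witness property (P) of \<open>G\<^sub>i\<close>. As \<open>G\<^sub>i\<close> has at least 3 vertices,
  the quadratic form of \<open>A\<^sub>i\<^sup>-\<^sup>1\<close> vanishes at some \<open>u\<^sub>i\<close> without zero entries. The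
  matrix with diagonal blocks \<open>A\<^sub>i\<close> and with blocks \<open>u\<^sub>i u\<^sub>j\<^sup>T\<close> at the edges ij of H lies in
  S(G), and isotropy of the \<open>u\<^sub>i\<close> makes the Woodbury formula terminate: the inverse has diagonal
  blocks \<open>A\<^sub>i\<^sup>-\<^sup>1\<close>, hence zero diagonal.
\<close>

section \<open>P-vertices and the diagonal of the inverse\<close>

text \<open>Multiplying \<open>(x - A) adj(x - A) = char_poly A\<close> from the left by
  \<open>C\<close> turns the left side into \<open>(x C - 1) adj(x - A)\<close>. This is a
  recurrence for the entries \<open>B i s\<close> of the adjugate. Its factor x allows the lowest
  coefficients at 0 to be read off one after the other.\<close>

lemma char_poly_mat_delete:
  fixes A C :: "real mat"
  assumes A: "A \<in> carrier_mat n n" and C: "C \<in> carrier_mat n n"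
    and CA: "C * A = 1\<^sub>m n"
  obtains B where
    "\<And>i s. i < n \<Longrightarrow> s < n \<Longrightarrow>
       B i s = [:0, 1:] * (\<Sum>r<n. [:C $$ (i, r):] * B r s) - char_poly A * [:C $$ (i, s):]"
    "\<And>i. i < n \<Longrightarrow> B i i = char_poly (mat_delete A i i)"
proof
  define M where "M = char_poly_matrix A"
  define K where "K = map_mat (\<lambda>c. [:c:]) C"
  have M: "M \<in> carrier_mat n n" and K: "K \<in> carrier_mat n n"
    using A C by (auto simp: M_def K_def)
  note adj = adj_mat[OF M]
  have p: "det M = char_poly A" by (simp add: M_def char_poly_def)
  have M_eq: "M = [:0, 1:] \<cdot>\<^sub>m 1\<^sub>m n + map_mat (\<lambda>a. [:- a:]) A"
    using A by (simp add: M_def char_poly_matrix_def)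
  have KA: "K * map_mat (\<lambda>a. [:- a:]) A = - 1\<^sub>m n"
  proof (rule eq_matI)
    fix i j assume ij: "i < dim_row (- 1\<^sub>m n :: real poly mat)" "j < dim_col (- 1\<^sub>m n :: real poly mat)"
    then have ij: "i < n" "j < n" by auto
    have "(\<Sum>r = 0..<n. C $$ (i, r) * A $$ (r, j)) = (C * A) $$ (i, j)"
      using A C ij by (simp add: scalar_prod_def)
    also have "\<dots> = (if i = j then 1 else 0)" using ij by (simp add: CA)
    finally have "(\<Sum>r = 0..<n. C $$ (i, r) * A $$ (r, j)) = (if i = j then 1 else 0)" .
    moreover have "(\<Sum>r = 0..<n. [:C $$ (i, r):] * [:- A $$ (r, j):])
        = [:- (\<Sum>r = 0..<n. C $$ (i, r) * A $$ (r, j)):]"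
      by (induction n) (auto simp: one_pCons)
    ultimately show "(K * map_mat (\<lambda>a. [:- a:]) A) $$ (i, j) = (- 1\<^sub>m n) $$ (i, j)"
      using A C ij by (auto simp: K_def scalar_prod_def one_pCons)
  qed (use A C in \<open>auto simp: K_def\<close>)
  have KM: "K * M = [:0, 1:] \<cdot>\<^sub>m K + - 1\<^sub>m n"
    using K A by (simp add: M_eq mult_add_distrib_mat[of _ n n _ n] mult_smult_distrib[of _ n n _ n] KA)
  have "(K * M) * adj_mat M = det M \<cdot>\<^sub>m K"
    using M K adj by (simp add: assoc_mult_mat[of _ n n _ n _ n] mult_smult_distrib[of _ n n _ n])
  then have *: "([:0, 1:] \<cdot>\<^sub>m K) * adj_mat M + - adj_mat M = det M \<cdot>\<^sub>m K"
    using K adj unfolding KM by (simp add: add_mult_distrib_mat[of _ n n])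
  show "adj_mat M $$ (i, s) = [:0, 1:] * (\<Sum>r<n. [:C $$ (i, r):] * adj_mat M $$ (r, s)) - char_poly A * [:C $$ (i, s):]"
    if "i < n" "s < n" for i s
  proof -
    have "(([:0, 1:] \<cdot>\<^sub>m K) * adj_mat M + - adj_mat M) $$ (i, s) = (det M \<cdot>\<^sub>m K) $$ (i, s)"
      by (simp only: *)
    then have "[:0, 1:] * (\<Sum>r<n. [:C $$ (i, r):] * adj_mat M $$ (r, s)) - adj_mat M $$ (i, s)
       = char_poly A * [:C $$ (i, s):]"
      using that K adj C unfolding p
      by (simp add: scalar_prod_def K_def atLeast0LessThan sum_distrib_left mult.assoc
          del: mult_pCons_left mult_pCons_right)
    then show ?thesis by (simp add: algebra_simps)
  qed
  show "adj_mat M $$ (i, i) = char_poly (mat_delete A i i)" if "i < n" for i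
  proof -
    have "mat_delete M i i = char_poly_matrix (mat_delete A i i)"
      using A that by (intro eq_matI) (auto simp: mat_delete_def M_eq char_poly_matrix_def)
    \<comment> \<open>The cofactor sign is \<open>(-1)^(i + i) = 1\<close>.\<close>
    then show ?thesis
      using M that by (simp add: adj_mat_def cofactor_def char_poly_def flip: mult_2)
  qed
qed

text \<open>
  The quotient of the characteristic polynomials of \<open>A(i)\<close> and \<open>A\<close> is the diagonal entry of the
  resolvent \<open>(x - A)\<^sup>-\<^sup>1 = - C - x C\<^sup>2 - \<dots>\<close>, and for symmetric C the entry of \<open>C\<^sup>2\<close> is positive, so
  the multiplicity of 0 never exceeds 1.
\<close>

lemma P_vertex_iff_inverse_diag_zero:
  assumes A: "A \<in> carrier_mat n n" and C: "C \<in> carrier_mat n n"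
    and CA: "C * A = 1\<^sub>m n" and sym: "transpose_mat C = C" and i: "i < n"
  shows "P_vertex A i \<longleftrightarrow> C $$ (i, i) = 0"
proof -
  obtain B where B: "\<And>i s. i < n \<Longrightarrow> s < n \<Longrightarrow>
       B i s = [:0, 1:] * (\<Sum>r<n. [:C $$ (i, r):] * B r s) - char_poly A * [:C $$ (i, s):]"
    and Bii: "\<And>i. i < n \<Longrightarrow> B i i = char_poly (mat_delete A i i)"
    using char_poly_mat_delete[OF A C CA] by blast
  have AC: "A * C = 1\<^sub>m n" by (rule mat_mult_left_right_inverse[OF C A CA])
  have p0: "poly (char_poly A) 0 \<noteq> 0"
  proof
    assume "poly (char_poly A) 0 = 0"
    then obtain v where v: "v \<in> carrier_vec n" "v \<noteq> 0\<^sub>v n" "A *\<^sub>v v = 0 \<cdot>\<^sub>v v"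
      using eigenvalue_root_char_poly[OF A] A by (auto simp: eigenvalue_def eigenvector_def)
    have "v = (C * A) *\<^sub>v v" using v CA by simp
    also have "\<dots> = C *\<^sub>v (A *\<^sub>v v)" using A C v by (simp add: assoc_mult_mat_vec)
    also have "\<dots> = 0\<^sub>v n" using v C by auto
    finally show False using v by simp
  qed
  have m0: "eig_mult A 0 = 0" using p0 by (simp add: eig_mult_def order_0I)
  define q where "q = char_poly (mat_delete A i i)"
  have q_eq: "q = [:0, 1:] * (\<Sum>r<n. [:C $$ (i, r):] * B r i) - char_poly A * [:C $$ (i, i):]"
    using B[OF i i] Bii[OF i] by (simp add: q_def)
  \<comment> \<open>At 0 the summand with the factor x drops out.\<close>
  have q0: "poly q 0 = - poly (char_poly A) 0 * C $$ (i, i)"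
    by (simp add: q_eq)
  have P: "P_vertex A i \<longleftrightarrow> Polynomial.order 0 q = 1"
    by (simp add: P_vertex_def m0 flip: q_def) (simp add: eig_mult_def q_def)
  show ?thesis
  proof
    assume "P_vertex A i"
    then have "poly q 0 = 0" using P order_0I by fastforce
    then show "C $$ (i, i) = 0" using q0 p0 by simp
  next
    assume Cii: "C $$ (i, i) = 0"
    define f where "f = (\<Sum>r<n. [:C $$ (i, r):] * B r i)"
    have q: "q = [:0, 1:] * f" using q_eq Cii by (simp add: f_def)
    have C_sym: "C $$ (r, i) = C $$ (i, r)" if "r < n" for r
      using arg_cong[OF sym, of "\<lambda>X. X $$ (r, i)"] that i C by simp
    \<comment> \<open>The recurrence is used a second time, now for \<open>B r i\<close> at 0. With
      the symmetry of \<open>C\<close> this produces the (i, i) entry of the square of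
      \<open>C\<close> as a sum of squares.\<close>
    have "poly f 0 = (\<Sum>r<n. C $$ (i, r) * (- poly (char_poly A) 0 * C $$ (i, r)))"
      unfolding f_def poly_sum using i C_sym by (intro sum.cong refl) (subst B, auto)
    also have "\<dots> = - poly (char_poly A) 0 * (\<Sum>r<n. (C $$ (i, r))\<^sup>2)"
      by (simp add: sum_distrib_left power2_eq_square algebra_simps sum_negf)
    finally have f0: "poly f 0 = - poly (char_poly A) 0 * (\<Sum>r<n. (C $$ (i, r))\<^sup>2)" .
    have "(\<Sum>r<n. (C $$ (i, r))\<^sup>2) \<noteq> 0"
    proof
      assume "(\<Sum>r<n. (C $$ (i, r))\<^sup>2) = 0"
      then have 0: "C $$ (i, r) = 0" if "r < n" for r
        using that by (simp add: sum_nonneg_eq_0_iff)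
      have "(C * A) $$ (i, i) = 0" using A C i 0 by (simp add: scalar_prod_def)
      then show False using CA i by simp
    qed
    then have "poly f 0 \<noteq> 0" using f0 p0 by simp
    \<comment> \<open>Cancelling one factor x, divisibility of \<open>q\<close> by its square would
      mean \<open>poly f 0 = 0\<close>. The spelling \<open>[:- 0, 1:]\<close> is the linear factor
      as it occurs in \<open>order_unique_lemma\<close>.\<close>
    then have "\<not> [:- 0, 1:] ^ Suc 1 dvd q"
      unfolding q power_Suc power_one_right minus_zero power_0 mult_1_right
      by (subst dvd_times_left_cancel_iff) (auto simp: poly_eq_0_iff_dvd)
    moreover have "[:- 0, 1:] ^ 1 dvd q" by (simp add: q del: mult_pCons_left)
    ultimately have "Polynomial.order 0 q = 1" by (rule order_unique_lemma[rotated])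
    then show "P_vertex A i" using P by simp
  qed
qed

section \<open>Property (P) with matrices indexed by vertices\<close>

text \<open>This is S(G) with the vertices themselves as row and column indices, so that block
  matrices over a join need no numbering.\<close>

definition graph_weights :: "'a pair_pre_digraph \<Rightarrow> ('a \<Rightarrow> 'a \<Rightarrow> real) \<Rightarrow> bool" where
  "graph_weights G a \<longleftrightarrow> (\<forall>x \<in> pverts G. \<forall>y \<in> pverts G.
     a x y = a y x \<and> (x \<noteq> y \<longrightarrow> (a x y \<noteq> 0 \<longleftrightarrow> (x, y) \<in> parcs G)))"

text \<open>On a finite \<open>V\<close> one product already makes \<open>c\<close> the two-sided
  inverse. The zero diagonal expresses that every vertex is a P-vertex.\<close>

definition hollow_inverse :: "'a set \<Rightarrow> ('a \<Rightarrow> 'a \<Rightarrow> real) \<Rightarrow> ('a \<Rightarrow> 'a \<Rightarrow> real) \<Rightarrow> bool" where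
  "hollow_inverse V a c \<longleftrightarrow>
     (\<forall>x \<in> V. \<forall>y \<in> V. (\<Sum>z\<in>V. a x z * c z y) = of_bool (x = y)) \<and>
     (\<forall>x \<in> V. \<forall>y \<in> V. c x y = c y x) \<and> (\<forall>x \<in> V. c x x = 0)"

lemma P_nu_eq_dim_iff:
  assumes A: "A \<in> carrier_mat n n" and C: "C \<in> carrier_mat n n"
    and CA: "C * A = 1\<^sub>m n" and sym: "transpose_mat C = C"
  shows "P_nu A = n \<longleftrightarrow> (\<forall>i < n. C $$ (i, i) = 0)"
proof -
  define Z where "Z = {i. i < n \<and> C $$ (i, i) = 0}"
  have eq: "{i. i < dim_row A \<and> P_vertex A i} = Z"
    using P_vertex_iff_inverse_diag_zero[OF A C CA sym] A by (auto simp: Z_def)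
  have sub: "Z \<subseteq> {..<n}" by (auto simp: Z_def)
  have "card Z = n \<longleftrightarrow> Z = {..<n}"
    using card_subset_eq[OF finite_lessThan sub] by auto
  also have "\<dots> \<longleftrightarrow> (\<forall>i < n. C $$ (i, i) = 0)" by (auto simp: Z_def)
  finally show ?thesis unfolding P_nu_def eq .
qed

text \<open>Pulls a matrix witness and its inverse back along the numbering of the vertices.\<close>

lemma property_PE:
  fixes G :: "'a pair_pre_digraph"
  assumes "property_P G"
  obtains a c where "graph_weights G a" "hollow_inverse (pverts G) a c"
proof -
  from assms obtain n G' A where V': "pverts G' = {0..<n}"
    and iso: "digraph_iso (with_proj G) (with_proj G')"
    and A: "A \<in> sym_mats n G'" "invertible_mat A" "P_nu A = n"
    unfolding property_P_def by blast
  from iso obtain hom where hom: "pre_digraph.digraph_isomorphism (with_proj G) hom"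
    and G': "with_proj G' = app_iso hom (with_proj G)"
    unfolding digraph_iso_def by blast
  define f where "f = iso_verts hom"
  interpret pre_digraph "with_proj G" .
  have wf: "wf_digraph (with_proj G)" using hom by (auto simp: digraph_isomorphism_def)
  have inj: "inj_on f (pverts G)" using hom by (auto simp: digraph_isomorphism_def f_def)
  have im: "f ` pverts G = {0..<n}"
    using arg_cong[OF G', of verts] V' by (simp add: f_def)
  have bij: "bij_betw f (pverts G) {0..<n}" using inj im by (auto simp: bij_betw_def)
  have fn: "f x < n" if "x \<in> pverts G" for x using im that by auto
  \<comment> \<open>Head and tail are the projections in both digraphs, which forces the arc map of
    \<open>hom\<close> to act as \<open>f\<close> on both endpoints.\<close>
  have heads: "iso_head hom = snd" "iso_tail hom = fst"
    using arg_cong[OF G', of head] arg_cong[OF G', of tail] by simp_all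
  have arc: "iso_arcs hom e = (f (fst e), f (snd e))" if "e \<in> parcs G" for e
    using hom that heads by (simp add: digraph_isomorphism_def f_def prod_eq_iff)
  have arcs': "parcs G' = iso_arcs hom ` parcs G"
    using arg_cong[OF G', of arcs] by simp
  have arc_iff: "(f x, f y) \<in> parcs G' \<longleftrightarrow> (x, y) \<in> parcs G"
    if xy: "x \<in> pverts G" "y \<in> pverts G" for x y
  proof
    assume "(f x, f y) \<in> parcs G'"
    then obtain e where e: "e \<in> parcs G" "(f x, f y) = (f (fst e), f (snd e))"
      using arcs' arc by auto
    then have "x = fst e" "y = snd e"
      using inj xy wf_digraph.wellformed[OF wf, of e] by (auto dest: inj_onD)
    then show "(x, y) \<in> parcs G" using e by simp
  qed (use arcs' arc in force)
  have Ac: "A \<in> carrier_mat n n" and At: "transpose_mat A = A"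
    and Ae: "\<And>i j. i < n \<Longrightarrow> j < n \<Longrightarrow> i \<noteq> j \<Longrightarrow> A $$ (i, j) \<noteq> 0 \<longleftrightarrow> (i, j) \<in> parcs G'"
    using A by (auto simp: sym_mats_def)
  from A(2) obtain C where "inverts_mat A C" "inverts_mat C A"
    unfolding invertible_mat_def by blast
  then have AC: "A * C = 1\<^sub>m n" and CA': "C * A = 1\<^sub>m (dim_row C)"
    using Ac by (auto simp: inverts_mat_def)
  \<comment> \<open>\<open>inverts_mat\<close> does not fix the shape of \<open>C\<close>; it is
    read off from the two products.\<close>
  have "dim_col C = n" using arg_cong[OF AC, of dim_col] by simp
  moreover have "dim_row C = n" using arg_cong[OF CA', of dim_col] Ac by simp
  ultimately have C: "C \<in> carrier_mat n n" by auto
  have CA: "C * A = 1\<^sub>m n" using CA' C by simp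
  \<comment> \<open>Transposing \<open>A * C = 1\<close> makes the transpose of \<open>C\<close> a
    left inverse of \<open>A\<close>, and a left inverse equals the right inverse
    \<open>C\<close>.\<close>
  have "transpose_mat C * A = 1\<^sub>m n"
    using transpose_mult[OF Ac C] AC At by simp
  then have "transpose_mat C * (A * C) = C"
    using Ac C by (simp flip: assoc_mult_mat[of _ n n _ n _ n])
  then have Ct: "transpose_mat C = C" using C AC by simp
  have C0: "C $$ (i, i) = 0" if "i < n" for i
    using P_nu_eq_dim_iff[OF Ac C CA Ct] A(3) that by simp
  have Asym: "A $$ (i, j) = A $$ (j, i)" if "i < n" "j < n" for i j
    using arg_cong[OF At, of "\<lambda>X. X $$ (i, j)"] that Ac by simp
  have Csym: "C $$ (i, j) = C $$ (j, i)" if "i < n" "j < n" for i j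
    using arg_cong[OF Ct, of "\<lambda>X. X $$ (i, j)"] that C by simp
  have prod: "(\<Sum>z\<in>pverts G. A $$ (f x, f z) * C $$ (f z, f y)) = of_bool (x = y)"
    if xy: "x \<in> pverts G" "y \<in> pverts G" for x y
  proof -
    have "(\<Sum>z\<in>pverts G. A $$ (f x, f z) * C $$ (f z, f y)) = (\<Sum>k = 0..<n. A $$ (f x, k) * C $$ (k, f y))"
      by (rule sum.reindex_bij_betw[OF bij])
    also have "\<dots> = (A * C) $$ (f x, f y)" using Ac C fn xy by (simp add: scalar_prod_def)
    also have "\<dots> = of_bool (x = y)" using AC fn xy inj by (auto dest: inj_onD)
    finally show ?thesis .
  qed
  show thesis
  proof (rule that)
    show "graph_weights G (\<lambda>x y. A $$ (f x, f y))"
      using Asym Ae arc_iff inj fn unfolding graph_weights_def by (metis inj_onD)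
    show "hollow_inverse (pverts G) (\<lambda>x y. A $$ (f x, f y)) (\<lambda>x y. C $$ (f x, f y))"
      using prod Csym C0 fn by (simp add: hollow_inverse_def)
  qed
qed

text \<open>Converse of \<open>property_PE\<close>: an arbitrary numbering \<open>g\<close> of the
  vertices transports both functions to matrices.\<close>

lemma property_PI:
  fixes G :: "'a pair_pre_digraph"
  assumes wf: "pair_wf_digraph G" and fin: "finite (pverts G)"
    and a: "graph_weights G a" and c: "hollow_inverse (pverts G) a c"
  shows "property_P G"
proof -
  define n where "n = card (pverts G)"
  obtain g where g: "bij_betw g {0..<n} (pverts G)"
    using ex_bij_betw_nat_finite[OF fin] by (auto simp: n_def)
  define f where "f = the_inv_into {0..<n} g"
  have f: "bij_betw f (pverts G) {0..<n}"
    unfolding f_def by (rule bij_betw_the_inv_into[OF g])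
  have gf: "g (f x) = x" if "x \<in> pverts G" for x
    using g that unfolding f_def by (metis bij_betw_def f_the_inv_into_f)
  have fg: "f (g i) = i" if "i < n" for i
    using g that unfolding f_def by (simp add: bij_betw_def the_inv_into_f_f)
  have gV: "g i \<in> pverts G" if "i < n" for i
    using g that by (auto simp: bij_betw_def)
  have g_eq: "g i = g j \<longleftrightarrow> i = j" if "i < n" "j < n" for i j
    using fg that by metis
  define G' where "G' = \<lparr>pverts = {0..<n}, parcs = map_prod f f ` parcs G\<rparr>"
  have arc_iff: "(i, j) \<in> parcs G' \<longleftrightarrow> (g i, g j) \<in> parcs G" if "i < n" "j < n" for i j
  proof
    assume "(i, j) \<in> parcs G'"
    then obtain x y where "(x, y) \<in> parcs G" "i = f x" "j = f y" by (auto simp: G'_def)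
    then show "(g i, g j) \<in> parcs G"
      using pair_wf_digraph.wellformed'[OF wf] by (auto simp: gf)
  next
    assume "(g i, g j) \<in> parcs G"
    then have "map_prod f f (g i, g j) \<in> parcs G'" unfolding G'_def by (auto intro!: imageI simp del: map_prod_simp)
    then show "(i, j) \<in> parcs G'" using fg that by simp
  qed
  define hom :: "('a, 'a \<times> 'a, nat, nat \<times> nat) digraph_isomorphism"
    where "hom = \<lparr>iso_verts = f, iso_arcs = map_prod f f, iso_head = snd, iso_tail = fst\<rparr>"
  have "inj_on (map_prod f f) (pverts G \<times> pverts G)"
    using f by (auto intro!: map_prod_inj_on simp: bij_betw_def)
  moreover have "parcs G \<subseteq> pverts G \<times> pverts G"
    using pair_wf_digraph.wellformed'[OF wf] by auto
  ultimately have "inj_on (map_prod f f) (parcs G)" by (rule inj_on_subset)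
  then have "pre_digraph.digraph_isomorphism (with_proj G) hom"
    using f wf by (auto simp: pre_digraph.digraph_isomorphism_def wf_digraph_wp_iff hom_def bij_betw_def)
  moreover have "with_proj G' = app_iso hom (with_proj G)"
    using f by (auto simp: with_proj_def G'_def app_iso_def hom_def bij_betw_def)
  ultimately have iso: "digraph_iso (with_proj G) (with_proj G')"
    unfolding digraph_iso_def by blast
  define A where "A = mat n n (\<lambda>(i, j). a (g i) (g j))"
  define C where "C = mat n n (\<lambda>(i, j). c (g i) (g j))"
  have A: "A \<in> carrier_mat n n" and C: "C \<in> carrier_mat n n" by (auto simp: A_def C_def)
  have AC: "A * C = 1\<^sub>m n"
  proof (rule eq_matI)
    fix i j assume "i < dim_row (1\<^sub>m n :: real mat)" "j < dim_col (1\<^sub>m n :: real mat)"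
    then have ij: "i < n" "j < n" by auto
    have "(A * C) $$ (i, j) = (\<Sum>k = 0..<n. a (g i) (g k) * c (g k) (g j))"
      using ij by (simp add: A_def C_def scalar_prod_def)
    also have "\<dots> = (\<Sum>z\<in>pverts G. a (g i) z * c z (g j))"
      by (rule sum.reindex_bij_betw[OF g])
    also have "\<dots> = of_bool (i = j)"
      using c gV g_eq ij by (simp add: hollow_inverse_def)
    finally show "(A * C) $$ (i, j) = 1\<^sub>m n $$ (i, j)" using ij by simp
  qed (auto simp: A_def C_def)
  have CA: "C * A = 1\<^sub>m n" by (rule mat_mult_left_right_inverse[OF A C AC])
  have "transpose_mat A = A" "transpose_mat C = C"
    using a c gV by (auto intro!: eq_matI simp: A_def C_def graph_weights_def hollow_inverse_def)
  moreover have "\<And>i j. i < n \<Longrightarrow> j < n \<Longrightarrow> i \<noteq> j \<Longrightarrow> A $$ (i, j) \<noteq> 0 \<longleftrightarrow> (i, j) \<in> parcs G'"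
    using a gV g_eq arc_iff by (simp add: A_def graph_weights_def)
  ultimately have "A \<in> sym_mats n G'" using A by (simp add: sym_mats_def)
  moreover have "invertible_mat A"
    using A C AC CA by (auto simp: invertible_mat_def inverts_mat_def)
  moreover have "P_nu A = n"
    using P_nu_eq_dim_iff[OF A C CA \<open>transpose_mat C = C\<close>] c gV
    by (simp add: C_def hollow_inverse_def)
  ultimately show ?thesis
    unfolding property_P_def using iso by (intro exI[of _ n] exI[of _ G']) (auto simp: G'_def)
qed

section \<open>Isotropic vectors without zero entries\<close>

text \<open>
  The form is affine in the coordinate \<open>u x\<close>, so once the other coordinates are generic (points of
  a curve) one can solve for \<open>u x\<close>. This needs C to have an entry off row and column x, which
  fails for two vertices.
\<close>

lemma isotropic_vector:
  assumes fin: "finite V" and card: "3 \<le> card V" and c: "hollow_inverse V a c"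
  obtains u :: "'a \<Rightarrow> real" where "\<forall>x\<in>V. u x \<noteq> 0" "(\<Sum>x\<in>V. \<Sum>y\<in>V. u x * c x y * u y) = 0"
proof -
  have inv: "(\<Sum>z\<in>V. a x z * c z y) = of_bool (x = y)" if "x \<in> V" "y \<in> V" for x y
    using c that by (simp add: hollow_inverse_def)
  have sym: "c x y = c y x" if "x \<in> V" "y \<in> V" for x y
    using c that by (simp add: hollow_inverse_def)
  have diag: "c x x = 0" if "x \<in> V" for x using c that by (simp add: hollow_inverse_def)
  obtain x where x: "x \<in> V" using card by (metis all_not_in_conv card.empty not_numeral_le_zero)
  define W where "W = V - {x}"
  have finW: "finite W" and VW: "V = insert x W" and xW: "x \<notin> W"
    using fin x by (auto simp: W_def)
  have cardW: "2 \<le> card W" using card fin x by (simp add: W_def)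
  \<comment> \<open>Otherwise column \<open>x\<close> of \<open>c\<close> vanishes, which
    contradicts the (x, x) entry of the product.\<close>
  have "\<exists>l\<in>W. c x l \<noteq> 0"
  proof (rule ccontr)
    assume "\<not> ?thesis"
    then have "c z x = 0" if "z \<in> V" for z using that VW sym x diag by auto
    then show False using inv[OF x x] by simp
  qed
  then obtain l where l: "l \<in> W" "c x l \<noteq> 0" by blast
  have "\<exists>j\<in>W. \<exists>k\<in>W. c j k \<noteq> 0"
  proof (rule ccontr)
    assume "\<not> ?thesis"
    then have 0: "c j k = 0" if "j \<in> W" "k \<in> W" for j k using that by blast
    \<comment> \<open>If \<open>c\<close> vanishes on pairs from \<open>W\<close>, only
      \<open>z = x\<close> survives in the product. Then a matrix of rank at most one is the
      identity on \<open>W\<close>, which is impossible for two elements.\<close>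
    have ac: "a j x * c x k = of_bool (j = k)" if "j \<in> W" "k \<in> W" for j k
      using inv[of j k] that 0 finW xW by (simp add: VW)
    obtain j k where jk: "j \<in> W" "k \<in> W" "j \<noteq> k"
      using cardW by (metis card_le_Suc0_iff_eq finW not_less_eq_eq numeral_2_eq_2)
    show False using ac[of j j] ac[of k k] ac[of j k] jk by auto
  qed
  then obtain j k where jk: "j \<in> W" "k \<in> W" "c j k \<noteq> 0" by blast
  then have "j \<noteq> k" using diag VW by auto
  \<comment> \<open>The curve: the constant 1 keeps all coordinates positive for t > 0, the linear
    term isolates \<open>c x l\<close> in the coefficient of t in \<open>L\<close>, and the
    quadratic term isolates \<open>2 * c j k\<close> in the coefficient of t^4 in
    \<open>R\<close>.\<close>
  define w :: "'a \<Rightarrow> real poly" where "w y = [:1, of_bool (y = l), of_bool (y \<in> {j, k}):]" for y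
  \<comment> \<open>Along the curve the form is \<open>2 * u x * L + R\<close>.\<close>
  define L where "L = (\<Sum>y\<in>W. Polynomial.smult (c x y) (w y))"
  define R where "R = (\<Sum>y\<in>W. \<Sum>z\<in>W. Polynomial.smult (c y z) (w y * w z))"
  have "coeff R 4 = (\<Sum>y\<in>W. \<Sum>z\<in>W. c y z * (of_bool (y \<in> {j, k}) * of_bool (z \<in> {j, k})))"
    by (simp add: R_def w_def coeff_sum numeral_eq_Suc mult.commute mult.left_commute del: of_bool_or_iff)
  also have "\<dots> = (\<Sum>y\<in>W. of_bool (y \<in> {j, k}) * (c y j + c y k))"
  proof (intro sum.cong refl)
    fix y assume "y \<in> W"
    have "(\<Sum>z\<in>W. c y z * (of_bool (y \<in> {j, k}) * of_bool (z \<in> {j, k})))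
        = (\<Sum>z\<in>{j, k}. c y z * (of_bool (y \<in> {j, k}) * of_bool (z \<in> {j, k})))"
      using jk finW by (intro sum.mono_neutral_right) auto
    then show "(\<Sum>z\<in>W. c y z * (of_bool (y \<in> {j, k}) * of_bool (z \<in> {j, k})))
        = of_bool (y \<in> {j, k}) * (c y j + c y k)" using \<open>j \<noteq> k\<close> by (simp add: algebra_simps)
  qed
  also have "\<dots> = (\<Sum>y\<in>{j, k}. of_bool (y \<in> {j, k}) * (c y j + c y k))"
    using jk finW by (intro sum.mono_neutral_right) auto
  also have "\<dots> = 2 * c j k" using \<open>j \<noteq> k\<close> jk sym diag VW by simp
  finally have "coeff R 4 \<noteq> 0" using jk by simp
  then have R: "R \<noteq> 0" by auto
  have "coeff L 1 = (\<Sum>y\<in>W. of_bool (y = l) * c x y)"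
    by (simp add: L_def w_def coeff_sum mult.commute)
  also have "\<dots> = c x l" using l finW by simp
  finally have L: "L \<noteq> 0" using l by auto
  \<comment> \<open>\<open>L\<close> must not vanish at t so that the equation can be solved for
    \<open>u x\<close>; \<open>R\<close> must not vanish so that the solution is nonzero.\<close>
  have "finite {t. poly (L * R) t = 0}" using L R by (intro poly_roots_finite) auto
  then obtain t where "t \<in> {0<..}" "t \<notin> {t. poly (L * R) t = 0}"
    using infinite_Ioi[of "0::real"] by (meson finite_subset subsetI)
  then have t: "t > 0" "poly L t \<noteq> 0" "poly R t \<noteq> 0" by auto
  define u where "u y = (if y = x then - poly R t / (2 * poly L t) else poly (w y) t)" for y
  show thesis
  proof (rule that)
    have "poly (w y) t > 0" for y using t by (simp add: w_def add_pos_nonneg)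
    then show "\<forall>y\<in>V. u y \<noteq> 0" using t by (auto simp: u_def less_imp_neq[symmetric])
    have uW: "u y = poly (w y) t" if "y \<in> W" for y using that xW by (auto simp: u_def)
    have Lu: "(\<Sum>y\<in>W. c x y * u y) = poly L t"
      by (simp add: L_def poly_sum uW)
    have Ru: "(\<Sum>y\<in>W. \<Sum>z\<in>W. u y * c y z * u z) = poly R t"
      by (simp add: R_def poly_sum uW algebra_simps)
    have "(\<Sum>y\<in>V. \<Sum>z\<in>V. u y * c y z * u z)
       = u x * (\<Sum>z\<in>W. c x z * u z) + (\<Sum>y\<in>W. u y * c y x * u x) + (\<Sum>y\<in>W. \<Sum>z\<in>W. u y * c y z * u z)"
      using finW xW diag[OF x] by (simp add: VW sum.distrib sum_distrib_left mult.assoc)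
    also have "(\<Sum>y\<in>W. u y * c y x * u x) = u x * (\<Sum>z\<in>W. c x z * u z)"
      unfolding sum_distrib_left using sym x VW by (intro sum.cong) auto
    finally have "(\<Sum>y\<in>V. \<Sum>z\<in>V. u y * c y z * u z)
       = u x * (\<Sum>z\<in>W. c x z * u z) + u x * (\<Sum>z\<in>W. c x z * u z)
         + (\<Sum>y\<in>W. \<Sum>z\<in>W. u y * c y z * u z)" .
    moreover have "u x = - poly R t / (2 * poly L t)" by (simp add: u_def)
    ultimately show "(\<Sum>y\<in>V. \<Sum>z\<in>V. u y * c y z * u z) = 0"
      using t unfolding Lu Ru by simp
  qed
qed

section \<open>Inverse of the block matrix of a join\<close>

text \<open>
  With \<open>D = diag(A\<^sub>i)\<close>, U the matrix with columns \<open>u\<^sub>i\<close> and \<open>U\<^sup>T D\<^sup>-\<^sup>1 U = 0\<close>, the inverse of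
  \<open>D + U h U\<^sup>T\<close> is \<open>D\<^sup>-\<^sup>1 - (D\<^sup>-\<^sup>1 U) h (D\<^sup>-\<^sup>1 U)\<^sup>T\<close>. The vector \<open>p\<close> collects the columns of \<open>D\<^sup>-\<^sup>1 U\<close>.
\<close>

lemma hollow_inverse_join:
  fixes I :: "'i set" and V :: "'i \<Rightarrow> 'a set" and h :: "'i \<Rightarrow> 'i \<Rightarrow> real"
  assumes finI: "finite I" and finV: "\<And>i. i \<in> I \<Longrightarrow> finite (V i)"
    and b: "\<And>i x. i \<in> I \<Longrightarrow> x \<in> V i \<Longrightarrow> b x = i"
    and inv: "\<And>i. i \<in> I \<Longrightarrow> hollow_inverse (V i) (a i) (c i)"
    and iso: "\<And>i. i \<in> I \<Longrightarrow> (\<Sum>x\<in>V i. \<Sum>y\<in>V i. u x * c i x y * u y) = 0"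
    and h_sym: "\<And>i j. h i j = h j i" and h_diag: "\<And>i. h i i = 0"
  defines "p \<equiv> \<lambda>x. \<Sum>z\<in>V (b x). c (b x) x z * u z"
  shows "hollow_inverse (\<Union>i\<in>I. V i)
     (\<lambda>x y. if b x = b y then a (b x) x y else h (b x) (b y) * u x * u y)
     (\<lambda>x y. if b x = b y then c (b x) x y else - h (b x) (b y) * p x * p y)"
    (is "hollow_inverse ?W ?a ?c")
proof -
  have ac: "(\<Sum>z\<in>V i. a i x z * c i z y) = of_bool (x = y)" if "i \<in> I" "x \<in> V i" "y \<in> V i" for i x y
    using inv that by (simp add: hollow_inverse_def)
  have c_sym: "c i x y = c i y x" if "i \<in> I" "x \<in> V i" "y \<in> V i" for i x y
    using inv that by (simp add: hollow_inverse_def)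
  have c_diag: "c i x x = 0" if "i \<in> I" "x \<in> V i" for i x
    using inv that by (simp add: hollow_inverse_def)
  have p: "p x = (\<Sum>z\<in>V i. c i x z * u z)" if "i \<in> I" "x \<in> V i" for i x
    using b that by (simp add: p_def)
  have ap: "(\<Sum>z\<in>V i. a i x z * p z) = u x" if "i \<in> I" "x \<in> V i" for i x
  proof -
    have "(\<Sum>z\<in>V i. a i x z * p z) = (\<Sum>z\<in>V i. \<Sum>y\<in>V i. a i x z * c i z y * u y)"
      using that p by (simp add: sum_distrib_left mult.assoc)
    also have "\<dots> = (\<Sum>y\<in>V i. (\<Sum>z\<in>V i. a i x z * c i z y) * u y)"
      by (subst sum.swap) (simp add: sum_distrib_right)
    also have "\<dots> = (\<Sum>y\<in>V i. of_bool (x = y) * u y)"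
      using ac that by simp
    also have "\<dots> = u x" using finV that by simp
    finally show ?thesis .
  qed
  \<comment> \<open>This is where isotropy enters; it removes the term quadratic in \<open>h\<close>
    from the product, in case 4 below.\<close>
  have up: "(\<Sum>z\<in>V i. u z * p z) = 0" if "i \<in> I" for i
    using iso[OF that] p[OF that] by (simp add: sum_distrib_left mult.assoc)
  have uc: "(\<Sum>z\<in>V i. u z * c i z y) = p y" if "i \<in> I" "y \<in> V i" for i y
    unfolding p[OF that] using that c_sym by (intro sum.cong) (auto simp: mult.commute)
  have prod: "(\<Sum>z\<in>?W. ?a x z * ?c z y) = of_bool (x = y)"
    if "i \<in> I" "x \<in> V i" "j \<in> I" "y \<in> V j" for x y i j
  proof -
    have bx: "b x = i" and "by": "b y = j" using b that by auto
    \<comment> \<open>Blocks are disjoint because \<open>b\<close> recovers the index of the block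
      from the element.\<close>
    have disj: "V k \<inter> V l = {}" if "k \<in> I" "l \<in> I" "k \<noteq> l" for k l
      using b that by blast
    \<comment> \<open>Contribution of block \<open>k\<close> to the (x, y) entry. Only the blocks of
      \<open>x\<close> and of \<open>y\<close> contribute.\<close>
    have block: "(\<Sum>z\<in>V k. ?a x z * ?c z y) =
        (if i = k then if k = j then of_bool (x = y) else - h k j * u x * p y else 0)
        + (if k = j then h i k * u x * p y else 0)" if k: "k \<in> I" for k
    proof -
      have bz: "b z = k" if "z \<in> V k" for z using b k that by blast
      consider "i = k" "k = j" | "i = k" "k \<noteq> j" | "i \<noteq> k" "k = j" | "i \<noteq> k" "k \<noteq> j" by blast
      then show ?thesis
      proof cases
        case 1
        then show ?thesis using ac that \<open>x \<in> V i\<close> \<open>y \<in> V j\<close> by (simp add: bx "by" bz h_diag)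
      next
        case 2
        have "(\<Sum>z\<in>V k. ?a x z * ?c z y) = (\<Sum>z\<in>V k. (- h k j * p y) * (a k x z * p z))"
          using 2 by (intro sum.cong) (auto simp: bx "by" bz)
        also have "\<dots> = - h k j * u x * p y"
          unfolding sum_distrib_left[symmetric] using 2 ap[of k x] k \<open>x \<in> V i\<close> by simp
        finally show ?thesis using 2 by simp
      next
        case 3
        have "(\<Sum>z\<in>V k. ?a x z * ?c z y) = (\<Sum>z\<in>V k. (h i k * u x) * (u z * c k z y))"
          using 3 by (intro sum.cong) (auto simp: bx "by" bz)
        also have "\<dots> = h i k * u x * p y"
          unfolding sum_distrib_left[symmetric] using 3 uc[of k y] k \<open>y \<in> V j\<close> by simp
        finally show ?thesis using 3 by simp
      next
        case 4
        have "(\<Sum>z\<in>V k. ?a x z * ?c z y) = (\<Sum>z\<in>V k. (- h i k * u x * h k j * p y) * (u z * p z))"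
          using 4 by (intro sum.cong) (auto simp: bx "by" bz)
        also have "\<dots> = 0" unfolding sum_distrib_left[symmetric] using up[OF k] by simp
        finally show ?thesis using 4 by simp
      qed
    qed
    have "(\<Sum>z\<in>?W. ?a x z * ?c z y) = (\<Sum>k\<in>I. \<Sum>z\<in>V k. ?a x z * ?c z y)"
      using finI finV disj by (intro sum.UNION_disjoint) auto
    also have "\<dots> = (\<Sum>k\<in>I. (if i = k then if k = j then of_bool (x = y) else - h k j * u x * p y else 0)
        + (if k = j then h i k * u x * p y else 0))"
      by (intro sum.cong refl block)
    \<comment> \<open>For different blocks the contributions from \<open>k = i\<close> and
      \<open>k = j\<close> are negatives of each other; for equal blocks \<open>h_diag\<close> kills
      the extra term.\<close>
    also have "\<dots> = (if i = j then of_bool (x = y) else - h i j * u x * p y) + h i j * u x * p y"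
      using finI that by (simp add: sum.distrib)
    also have "\<dots> = of_bool (x = y)"
      using bx "by" by (auto simp: h_diag)
    finally show ?thesis .
  qed
  have "?c x y = ?c y x" if "i \<in> I" "x \<in> V i" "j \<in> I" "y \<in> V j" for x y i j
    using c_sym h_sym[of i j] that b by (auto simp: b[OF that(1,2)] b[OF that(3,4)])
  moreover have "?c x x = 0" if "i \<in> I" "x \<in> V i" for x i
    using c_diag that b by simp
  ultimately show ?thesis
    using prod unfolding hollow_inverse_def by blast
qed

section \<open>Arcs of the join and assembly of the witness\<close>

lemma pair_wf_digraph_h_join:
  assumes "pair_wf_digraph H" and "\<And>i. i \<in> pverts H \<Longrightarrow> pair_wf_digraph (Gs i)"
  shows "pair_wf_digraph (h_join H Gs)"
proof
  fix e assume "e \<in> parcs (h_join H Gs)"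
  then consider i where "i \<in> pverts H" "e \<in> parcs (Gs i)"
    | i j where "(i, j) \<in> parcs H" "e \<in> pverts (Gs i) \<times> pverts (Gs j)"
    by (auto simp: h_join_def)
  then have "fst e \<in> pverts (h_join H Gs) \<and> snd e \<in> pverts (h_join H Gs)"
  proof cases
    case 1
    then have "fst e \<in> pverts (Gs i)" "snd e \<in> pverts (Gs i)"
      using assms(2) pair_wf_digraph.arc_fst_in_verts pair_wf_digraph.arc_snd_in_verts by blast+
    then show ?thesis using 1 by (auto simp: h_join_def)
  next
    case 2
    then show ?thesis using pair_wf_digraph.wellformed'[OF assms(1) 2(1)]
      by (auto simp: h_join_def)
  qed
  then show "fst e \<in> pverts (h_join H Gs)" "snd e \<in> pverts (h_join H Gs)" by auto
qed

text \<open>Disjointness determines the part of each endpoint, and without loops in \<open>H\<close>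
  the arcs inside a part come only from that part.\<close>

lemma h_join_arc_iff:
  assumes wf: "pair_wf_digraph H" and loopfree: "\<And>i. (i, i) \<notin> parcs H"
    and wfG: "\<And>i. i \<in> pverts H \<Longrightarrow> pair_wf_digraph (Gs i)"
    and disj: "disjoint_family_on (\<lambda>i. pverts (Gs i)) (pverts H)"
    and i: "i \<in> pverts H" "x \<in> pverts (Gs i)" and j: "j \<in> pverts H" "y \<in> pverts (Gs j)"
  shows "(x, y) \<in> parcs (h_join H Gs) \<longleftrightarrow> (if i = j then (x, y) \<in> parcs (Gs i) else (i, j) \<in> parcs H)"
proof -
  have uniq: "k = l" if "k \<in> pverts H" "z \<in> pverts (Gs k)" "l \<in> pverts H" "z \<in> pverts (Gs l)" for k l z
    using disj that by (auto simp: disjoint_family_on_def)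
  have "(x, y) \<in> parcs (Gs k) \<Longrightarrow> k \<in> pverts H \<Longrightarrow> k = i \<and> k = j" for k
    using uniq i j pair_wf_digraph.wellformed'[OF wfG] by metis
  moreover have "(k, l) \<in> parcs H \<Longrightarrow> x \<in> pverts (Gs k) \<Longrightarrow> y \<in> pverts (Gs l) \<Longrightarrow> k = i \<and> l = j" for k l
    using uniq i j pair_wf_digraph.wellformed'[OF wf] by metis
  moreover have "(x, y) \<in> parcs (h_join H Gs) \<longleftrightarrow> (\<exists>k\<in>pverts H. (x, y) \<in> parcs (Gs k)) \<or>
      (\<exists>k l. (k, l) \<in> parcs H \<and> x \<in> pverts (Gs k) \<and> y \<in> pverts (Gs l))"
    by (auto simp: h_join_def)
  ultimately have "(x, y) \<in> parcs (h_join H Gs) \<longleftrightarrow> i = j \<and> (x, y) \<in> parcs (Gs i) \<or> (i, j) \<in> parcs H"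
    using i j by blast
  then show ?thesis using loopfree by auto
qed

theorem property_P_h_join:
  fixes Gs :: "'i \<Rightarrow> 'a pair_pre_digraph"
  assumes H: "pair_graph H"
    and G: "\<And>i. i \<in> pverts H \<Longrightarrow> pair_graph (Gs i)"
    and disj: "disjoint_family_on (\<lambda>i. pverts (Gs i)) (pverts H)"
    and card: "\<And>i. i \<in> pverts H \<Longrightarrow> 3 \<le> card (pverts (Gs i))"
    and P: "\<And>i. i \<in> pverts H \<Longrightarrow> property_P (Gs i)"
  shows "property_P (h_join H Gs)"
proof -
  interpret H: pair_graph H by fact
  have wfG: "pair_wf_digraph (Gs i)" if "i \<in> pverts H" for i
    using G[OF that] by (simp add: pair_graph_def pair_digraph_def pair_fin_digraph_def)
  have finG: "finite (pverts (Gs i))" if "i \<in> pverts H" for i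
    using card[OF that] by (intro card_ge_0_finite) simp
  have "\<forall>i\<in>pverts H. \<exists>a c u. graph_weights (Gs i) a \<and> hollow_inverse (pverts (Gs i)) a c \<and>
      (\<forall>x\<in>pverts (Gs i). u x \<noteq> 0) \<and>
      (\<Sum>x\<in>pverts (Gs i). \<Sum>y\<in>pverts (Gs i). u x * c x y * u y) = 0"
  proof
    fix i assume i: "i \<in> pverts H"
    obtain a c where ac: "graph_weights (Gs i) a" "hollow_inverse (pverts (Gs i)) a c"
      using property_PE[OF P[OF i]] .
    obtain u where "\<forall>x\<in>pverts (Gs i). u x \<noteq> 0"
      "(\<Sum>x\<in>pverts (Gs i). \<Sum>y\<in>pverts (Gs i). u x * c x y * u y) = 0"
      using isotropic_vector[OF finG[OF i] card[OF i] ac(2)] .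
    with ac show "\<exists>a c u. graph_weights (Gs i) a \<and> hollow_inverse (pverts (Gs i)) a c \<and>
      (\<forall>x\<in>pverts (Gs i). u x \<noteq> 0) \<and>
      (\<Sum>x\<in>pverts (Gs i). \<Sum>y\<in>pverts (Gs i). u x * c x y * u y) = 0" by blast
  qed
  then obtain a c w where a: "\<And>i. i \<in> pverts H \<Longrightarrow> graph_weights (Gs i) (a i)"
    and c: "\<And>i. i \<in> pverts H \<Longrightarrow> hollow_inverse (pverts (Gs i)) (a i) (c i)"
    and w: "\<And>i x. i \<in> pverts H \<Longrightarrow> x \<in> pverts (Gs i) \<Longrightarrow> w i x \<noteq> (0::real)"
    and iso: "\<And>i. i \<in> pverts H \<Longrightarrow>
      (\<Sum>x\<in>pverts (Gs i). \<Sum>y\<in>pverts (Gs i). w i x * c i x y * w i y) = 0"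
    unfolding bchoice_iff by blast
  \<comment> \<open>Disjointness makes this description unique on the vertices of the join.\<close>
  define b where "b x = (THE i. i \<in> pverts H \<and> x \<in> pverts (Gs i))" for x
  have b: "b x = i" if "i \<in> pverts H" "x \<in> pverts (Gs i)" for i x
    unfolding b_def using disj that by (intro the_equality) (auto simp: disjoint_family_on_def)
  define u where "u x = w (b x) x" for x
  \<comment> \<open>The adjacency matrix of \<open>H\<close>: symmetric, with zero diagonal, and
    nonzero exactly at its arcs.\<close>
  define h :: "'i \<Rightarrow> 'i \<Rightarrow> real" where "h i j = of_bool ((i, j) \<in> parcs H)" for i j
  have arc_sym: "(i, j) \<in> parcs H \<longleftrightarrow> (j, i) \<in> parcs H" for i j
    using H.pair_sym_arcs by (auto simp: symmetric_def dest: symD)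
  have loopfree: "(i, i) \<notin> parcs H" for i using H.pair_no_loops by fastforce
  have V: "pverts (h_join H Gs) = (\<Union>i\<in>pverts H. pverts (Gs i))" by (simp add: h_join_def)
  define A where "A x y = (if b x = b y then a (b x) x y else h (b x) (b y) * u x * u y)" for x y
  have iso_u: "(\<Sum>x\<in>pverts (Gs i). \<Sum>y\<in>pverts (Gs i). u x * c i x y * u y) = 0"
    if "i \<in> pverts H" for i
    using iso[OF that] b[OF that] by (simp add: u_def)
  have "\<exists>C. hollow_inverse (\<Union>i\<in>pverts H. pverts (Gs i)) A C"
    unfolding A_def
    using hollow_inverse_join[of "pverts H" "\<lambda>i. pverts (Gs i)" b a c u h,
        OF H.pair_finite_verts finG b c iso_u]
      arc_sym loopfree
    by (auto simp: h_def)
  then obtain C where C: "hollow_inverse (pverts (h_join H Gs)) A C" unfolding V by blast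
  have "A x y = A y x \<and> (x \<noteq> y \<longrightarrow> (A x y \<noteq> 0 \<longleftrightarrow> (x, y) \<in> parcs (h_join H Gs)))"
    if x: "i \<in> pverts H" "x \<in> pverts (Gs i)" and y: "j \<in> pverts H" "y \<in> pverts (Gs j)" for x y i j
  proof -
    have "(x, y) \<in> parcs (h_join H Gs) \<longleftrightarrow> (if i = j then (x, y) \<in> parcs (Gs i) else (i, j) \<in> parcs H)"
      using h_join_arc_iff[OF H.pair_wf_digraph loopfree wfG disj x y] .
    \<comment> \<open>Since \<open>u\<close> has no zero entries, \<open>h i j * u x * u y\<close>
      is nonzero exactly when ij is an edge of \<open>H\<close>.\<close>
    moreover have "u x \<noteq> 0" "u y \<noteq> 0" using w x y b by (auto simp: u_def)
    moreover have "b x = i" "b y = j" using b x y by auto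
    moreover have "a i x y = a i y x \<and> (x \<noteq> y \<longrightarrow> (a i x y \<noteq> 0 \<longleftrightarrow> (x, y) \<in> parcs (Gs i)))" if "i = j"
      using a[OF x(1)] x y that unfolding graph_weights_def by blast
    ultimately show ?thesis
      using arc_sym[of i j] by (cases "i = j") (auto simp: A_def h_def)
  qed
  then have "graph_weights (h_join H Gs) A" unfolding graph_weights_def V by blast
  moreover have "pair_wf_digraph (h_join H Gs)"
    using H.pair_wf_digraph wfG by (rule pair_wf_digraph_h_join)
  moreover have "finite (pverts (h_join H Gs))" unfolding V using H.pair_finite_verts finG by blast
  ultimately show ?thesis using C by (intro property_PI)
qed

theorem corollary4p4:
  fixes G :: "'b pair_pre_digraph"
    and H :: "nat pair_pre_digraph"
    and Gs :: "nat \<Rightarrow> 'a pair_pre_digraph"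
    and k :: nat
  assumes "pverts H = {1..k}"
    and "cograph H"
    and "\<And>i. i \<in> {1..k} \<Longrightarrow> cograph (Gs i)"
    and "disjoint_family_on (\<lambda>i. pverts (Gs i)) {1..k}"
    and "pair_graph G"
    and "digraph_iso (with_proj G) (with_proj (h_join H Gs))"
    and "\<And>i. i \<in> {1..k} \<Longrightarrow> 3 \<le> card (pverts (Gs i))"
    and "\<And>i. i \<in> {1..k} \<Longrightarrow> property_P (Gs i)"
  shows "property_P G"
proof -
  have "property_P (h_join H Gs)"
    using assms by (intro property_P_h_join) (auto simp: cograph_def)
  \<comment> \<open>\<open>property_P\<close> refers to a graph only through an isomorphism to a
    numbered copy, so transitivity of \<open>digraph_iso\<close> carries it over to
    \<open>G\<close>.\<close>
  then show ?thesis
    using digraph_iso_trans[OF assms(6)] unfolding property_P_def by blast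
qed

end
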